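(* Let $G$ be a graph on $n$ vertices with adjacency matrix $A$ and let $k \leq n$ be a positive integer. Let $x^* \in \{0,1\}^n$ be an optimal solution of (SkS) and let $\mu\in\mathbb{R}$ satisfy $\frac{\mu}{2} > k-1$. Then: (i) $$\frac{1}{2}x^{*T}Ax^* < \frac{1}{2}x^TAx + \frac{\mu}{2}(e^Tx-k)^2$$ for all $x \in \{0,1\}^n$ with $e^Tx \neq k$. (ii) Any optimal solution of (SkS-Q) with this $\mu$ is an optimal solution of (SkS).
   Context: Graphs are simple, undirected and finite, with vertex set $\{1,\dots,n\}$; $A$ is the adjacency matrix of $G$ and $e$ is the all-ones vector of length $n$. The sparsest $k$-subgraph problem is $$\text{(SkS)}\qquad \min\left\{\tfrac12 x^TAx \mid e^Tx=k,\ x\in\{0,1\}^n\right\}.$$ Its quadratic penalty relaxation with parameter $\mu>0$ is $$\text{(SkS-Q)}\qquad \min\left\{\tfrac12 x^TAx+\tfrac{\mu}{2}(e^Tx-k)^2 \mid x\in\{0,1\}^n\right\}.$$ *)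

theory Defs
  imports "HOL-Analysis.Analysis"
begin

text \<open>
  The vertex set is the finite index type \<open>'n\<close>, so the number of vertices is \<open>CARD('n)\<close>;
  a graph is given by its set of edges, which are unordered pairs of distinct vertices.
\<close>

definition simple_graph :: "'n::finite set set \<Rightarrow> bool" where
  "simple_graph E \<longleftrightarrow> (\<forall>e\<in>E. card e = 2)"

definition adjacency_matrix :: "'n::finite set set \<Rightarrow> real ^ 'n ^ 'n" where
  "adjacency_matrix E = (\<chi> i j. if {i, j} \<in> E then 1 else 0)"

definition all_ones :: "real ^ 'n::finite" where
  "all_ones = (\<chi> i. 1)"

definition binary_vec :: "real ^ 'n::finite \<Rightarrow> bool" where
  "binary_vec x \<longleftrightarrow> (\<forall>i. x $ i \<in> {0, 1})"

definition sks_objective :: "real ^ 'n ^ 'n::finite \<Rightarrow> real ^ 'n \<Rightarrow> real" where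
  "sks_objective A x = 1/2 * (x \<bullet> (A *v x))"

definition sks_feasible :: "nat \<Rightarrow> real ^ 'n::finite \<Rightarrow> bool" where
  "sks_feasible k x \<longleftrightarrow> all_ones \<bullet> x = real k \<and> binary_vec x"

definition sksq_objective :: "real ^ 'n ^ 'n::finite \<Rightarrow> nat \<Rightarrow> real \<Rightarrow> real ^ 'n \<Rightarrow> real" where
  "sksq_objective A k \<mu> x = 1/2 * (x \<bullet> (A *v x)) + \<mu>/2 * (all_ones \<bullet> x - real k)\<^sup>2"

definition sks_optimal :: "real ^ 'n ^ 'n::finite \<Rightarrow> nat \<Rightarrow> real ^ 'n \<Rightarrow> bool" where
  "sks_optimal A k = is_arg_min (sks_objective A) (sks_feasible k)"

definition sksq_optimal :: "real ^ 'n ^ 'n::finite \<Rightarrow> nat \<Rightarrow> real \<Rightarrow> real ^ 'n \<Rightarrow> bool" where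
  "sksq_optimal A k \<mu> = is_arg_min (sksq_objective A k \<mu>) binary_vec"

end

theory Submission
  imports Defs
begin

text \<open>
  Write \<open>f S\<close> for the number of edges inside a vertex set \<open>S\<close>. If \<open>S\<close> has more than \<open>k\<close> vertices,
  shrinking it to \<open>k\<close> vertices does not increase \<open>f\<close>, while the penalty at \<open>S\<close> is positive.
  If \<open>S\<close> has \<open>k - d\<close> vertices with \<open>d > 0\<close>, enlarge it to a set of \<open>k\<close> vertices: each of the
  \<open>d\<close> new vertices has at most \<open>k - 1\<close> neighbours there, so \<open>f\<close> grows by at most
  \<open>d * (k - 1) \<le> d\<^sup>2 * (k - 1)\<close>, which is less than the penalty.
\<close>

text \<open>Binary vectors are exactly the vectors of this form, so the argument can run on vertex
  sets, with \<open>card S\<close> in place of the linear constraint.\<close>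

definition ind_vec :: "'n::finite set \<Rightarrow> real ^ 'n" where
  "ind_vec S = (\<chi> i. indicator S i)"

lemma binary_vec_ind_vec: "binary_vec (ind_vec S)"
  by (simp add: binary_vec_def ind_vec_def indicator_def)

lemma binary_vecE:
  assumes "binary_vec x"
  obtains S where "x = ind_vec S"
proof
  show "x = ind_vec {i. x $ i = 1}"
    using assms by (auto simp: binary_vec_def ind_vec_def indicator_def vec_eq_iff)
qed

lemma all_ones_ind_vec: "all_ones \<bullet> ind_vec S = real (card S)"
  by (simp add: all_ones_def ind_vec_def inner_vec_def indicator_def)

lemma sks_feasible_ind_vec: "sks_feasible k (ind_vec S) \<longleftrightarrow> card S = k"
  by (simp add: sks_feasible_def all_ones_ind_vec binary_vec_ind_vec)

text \<open>For the adjacency matrix of a simple graph the double sum counts each edge inside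
  \<open>S\<close> twice, which the factor 1/2 in the objective undoes.\<close>

lemma quadratic_form_ind_vec:
  "ind_vec S \<bullet> (A *v ind_vec S) = (\<Sum>i\<in>S. \<Sum>j\<in>S. A $ i $ j)"
proof -
  have "(A *v ind_vec S) $ i = (\<Sum>j\<in>S. A $ i $ j)" for i
    by (simp add: matrix_vector_mult_def ind_vec_def)
  then show ?thesis
    by (simp add: inner_vec_def ind_vec_def)
qed

text \<open>Outside the block of \<open>S\<close>, the entries lie in the rows of
  \<open>T - S\<close> or in the columns of \<open>T - S\<close>. By symmetry the columns contribute
  no more than the rows, hence the factor 2, and each row sums to at most
  \<open>card T - 1\<close>.\<close>

lemma double_sum_le_extend:
  fixes a :: "'a \<Rightarrow> 'a \<Rightarrow> real"
  assumes "finite T" "S \<subseteq> T"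
    and sym: "\<And>i j. a i j = a j i" and diag: "\<And>i. a i i = 0"
    and nonneg: "\<And>i j. 0 \<le> a i j" and le1: "\<And>i j. a i j \<le> 1"
  shows "(\<Sum>i\<in>T. \<Sum>j\<in>T. a i j)
    \<le> (\<Sum>i\<in>S. \<Sum>j\<in>S. a i j) + 2 * (real (card T) - real (card S)) * (real (card T) - 1)"
proof -
  let ?D = "T - S"
  have split: "sum g T = sum g ?D + sum g S" for g :: "'a \<Rightarrow> real"
    by (rule sum.subset_diff[OF assms(2,1)])
  have row: "(\<Sum>j\<in>T. a i j) \<le> real (card T) - 1" if "i \<in> T" for i
  proof -
    \<comment> \<open>Dropping the zero diagonal entry is what improves the row bound from
      \<open>card T\<close> to \<open>card T - 1\<close>.\<close>
    have "(\<Sum>j\<in>T. a i j) = (\<Sum>j\<in>T - {i}. a i j)"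
      using that \<open>finite T\<close> by (simp add: sum.remove diag)
    also have "\<dots> \<le> real (card (T - {i})) * 1"
      by (rule sum_bounded_above) (rule le1)
    also have "\<dots> = real (card T) - 1"
      using card_Suc_Diff1[OF \<open>finite T\<close> that] by linarith
    finally show ?thesis .
  qed
  have "(\<Sum>i\<in>?D. \<Sum>j\<in>T. a i j) \<le> real (card ?D) * (real (card T) - 1)"
    by (rule sum_bounded_above) (use row in auto)
  also have "real (card ?D) = real (card T) - real (card S)"
    using assms(1,2) by (simp add: card_Diff_subset finite_subset card_mono of_nat_diff)
  finally have new: "(\<Sum>i\<in>?D. \<Sum>j\<in>T. a i j)
    \<le> (real (card T) - real (card S)) * (real (card T) - 1)" .
  have "(\<Sum>i\<in>S. \<Sum>j\<in>?D. a i j) = (\<Sum>i\<in>?D. \<Sum>j\<in>S. a i j)"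
    by (subst sum.swap) (simp add: sym)
  also have "\<dots> \<le> (\<Sum>i\<in>?D. \<Sum>j\<in>T. a i j)"
    using assms(1,2) nonneg by (intro sum_mono sum_mono2) auto
  finally have cross: "(\<Sum>i\<in>S. \<Sum>j\<in>?D. a i j) \<le> (\<Sum>i\<in>?D. \<Sum>j\<in>T. a i j)" .
  have "(\<Sum>i\<in>T. \<Sum>j\<in>T. a i j)
      = (\<Sum>i\<in>?D. \<Sum>j\<in>T. a i j) + (\<Sum>i\<in>S. \<Sum>j\<in>?D. a i j) + (\<Sum>i\<in>S. \<Sum>j\<in>S. a i j)"
    by (simp only: split[of "\<lambda>i. \<Sum>j\<in>T. a i j"])
      (simp add: split[of "a _"] sum.distrib)
  then show ?thesis
    using new cross by linarith
qed

lemma adjacency_matrix_nonneg: "0 \<le> adjacency_matrix E $ i $ j"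
  by (simp add: adjacency_matrix_def)

lemma adjacency_matrix_le_1: "adjacency_matrix E $ i $ j \<le> 1"
  by (simp add: adjacency_matrix_def)

lemma adjacency_matrix_sym: "adjacency_matrix E $ i $ j = adjacency_matrix E $ j $ i"
  by (simp add: adjacency_matrix_def insert_commute)

lemma adjacency_matrix_diag:
  assumes "simple_graph E"
  shows "adjacency_matrix E $ i $ i = 0"
  using assms by (auto simp: adjacency_matrix_def simple_graph_def)

text \<open>Passing to a subset only discards nonnegative entries. This handles sets with more than
  \<open>k\<close> vertices.\<close>

lemma sks_objective_subset:
  assumes "S \<subseteq> T"
  shows "sks_objective (adjacency_matrix E) (ind_vec S)
    \<le> sks_objective (adjacency_matrix E) (ind_vec T)"
proof -
  have "(\<Sum>i\<in>S. \<Sum>j\<in>S. adjacency_matrix E $ i $ j) \<le> (\<Sum>i\<in>S. \<Sum>j\<in>T. adjacency_matrix E $ i $ j)"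
    using assms by (intro sum_mono sum_mono2) (auto simp: adjacency_matrix_nonneg)
  also have "\<dots> \<le> (\<Sum>i\<in>T. \<Sum>j\<in>T. adjacency_matrix E $ i $ j)"
    using assms by (intro sum_mono2) (auto intro: sum_nonneg simp: adjacency_matrix_nonneg)
  finally show ?thesis
    by (simp add: sks_objective_def quadratic_form_ind_vec)
qed

text \<open>Each new vertex brings at most \<open>card T - 1\<close> edges; the 1/2 in the objective
  cancels the 2 of \<open>double_sum_le_extend\<close>.\<close>

lemma sks_objective_extend:
  assumes "simple_graph E" "S \<subseteq> T"
  shows "sks_objective (adjacency_matrix E) (ind_vec T)
    \<le> sks_objective (adjacency_matrix E) (ind_vec S)
      + (real (card T) - real (card S)) * (real (card T) - 1)"
  using double_sum_le_extend[of T S "\<lambda>i j. adjacency_matrix E $ i $ j", OF _ assms(2)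
      adjacency_matrix_sym adjacency_matrix_diag[OF assms(1)]
      adjacency_matrix_nonneg adjacency_matrix_le_1]
  by (simp add: sks_objective_def quadratic_form_ind_vec field_simps)

lemma exists_card_between:
  fixes S :: "'n::finite set"
  assumes "card S \<le> k" "k \<le> CARD('n)"
  obtains T where "S \<subseteq> T" "card T = k"
proof -
  have "k - card S \<le> card (- S)"
    using assms by (simp add: Compl_eq_Diff_UNIV card_Diff_subset)
  then obtain U where U: "U \<subseteq> - S" "card U = k - card S"
    by (meson obtain_subset_with_card_n)
  then have "card (S \<union> U) = k"
    using assms(1) by (subst card_Un_disjoint) auto
  then show ?thesis
    using that[of "S \<union> U"] by simp
qed

lemma sksq_objective_eq:
  "sksq_objective A k \<mu> x = sks_objective A x + \<mu>/2 * (all_ones \<bullet> x - real k)\<^sup>2"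
  by (simp add: sksq_objective_def sks_objective_def)

lemma sks_optimal_less_sksq_objective:
  fixes E :: "'n::finite set set"
  assumes "simple_graph E" "0 < k" "k \<le> CARD('n)"
    and opt: "sks_optimal (adjacency_matrix E) k x_opt"
    and \<mu>: "\<mu> / 2 > real k - 1"
    and x: "binary_vec x" "all_ones \<bullet> x \<noteq> real k"
  shows "sks_objective (adjacency_matrix E) x_opt < sksq_objective (adjacency_matrix E) k \<mu> x"
proof -
  let ?f = "\<lambda>S. sks_objective (adjacency_matrix E) (ind_vec S)"
  obtain S where S: "x = ind_vec S" using x(1) by (rule binary_vecE)
  with x(2) have neq: "card S \<noteq> k" by (simp add: all_ones_ind_vec)
  \<comment> \<open>Optimality of \<open>x_opt\<close> enters only here, as a comparison with every
    set of \<open>k\<close> vertices.\<close>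
  have min: "sks_objective (adjacency_matrix E) x_opt \<le> ?f T" if "card T = k" for T
    using opt that by (auto simp: sks_optimal_def is_arg_min_linorder sks_feasible_ind_vec)
  have "sks_objective (adjacency_matrix E) x_opt
      < ?f S + \<mu>/2 * (real (card S) - real k)\<^sup>2"
  proof (cases "k < card S")
    case True
    then obtain T where T: "T \<subseteq> S" "card T = k"
      by (meson obtain_subset_with_card_n less_imp_le)
    \<comment> \<open>Since \<open>k\<close> is at least 1, the bound on \<open>\<mu>\<close> forces
      \<open>\<mu>/2 > 0\<close>.\<close>
    have "0 < \<mu>/2 * (real (card S) - real k)\<^sup>2"
      using \<mu> \<open>0 < k\<close> neq by (intro mult_pos_pos) auto
    then show ?thesis
      using min[OF T(2)] sks_objective_subset[OF T(1), of E] by linarith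
  next
    case False
    with neq have less: "card S < k" by simp
    then obtain T where T: "S \<subseteq> T" "card T = k"
      using exists_card_between[of S k] assms(3) by auto
    define d where "d = real k - real (card S)"
    have d: "1 \<le> d" using less by (simp add: d_def)
    \<comment> \<open>As \<open>card S\<close> and \<open>k\<close> are integers, the gap satisfies
      \<open>d \<ge> 1\<close>, so the linear growth in \<open>d\<close> is dominated by the
      quadratic penalty.\<close>
    have "d * (real k - 1) \<le> d\<^sup>2 * (real k - 1)"
      using d \<open>0 < k\<close> by (intro mult_right_mono) (auto simp: power2_eq_square)
    also have "\<dots> < d\<^sup>2 * (\<mu>/2)"
      using d \<mu> by (intro mult_strict_left_mono) auto
    finally have "d * (real k - 1) < \<mu>/2 * (real (card S) - real k)\<^sup>2"
      by (simp add: d_def power2_commute mult.commute)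
    moreover have "?f T \<le> ?f S + d * (real k - 1)"
      using sks_objective_extend[OF assms(1) T(1)] T(2) by (simp add: d_def)
    ultimately show ?thesis
      using min[OF T(2)] by linarith
  qed
  then show ?thesis
    by (simp add: S sksq_objective_eq all_ones_ind_vec)
qed

theorem lemma4:
  fixes E :: "'n::finite set set" and A :: "real ^ 'n ^ 'n"
    and k :: nat and \<mu> :: real and x_opt :: "real ^ 'n"
  assumes "simple_graph E" and "A = adjacency_matrix E"
    and "0 < k" and "k \<le> CARD('n)"
    and "sks_optimal A k x_opt"
    and "\<mu> / 2 > real k - 1"
  shows "(\<forall>x::real ^ 'n. binary_vec x \<and> all_ones \<bullet> x \<noteq> real k \<longrightarrow>
            1/2 * (x_opt \<bullet> (A *v x_opt))
              < 1/2 * (x \<bullet> (A *v x)) + \<mu>/2 * (all_ones \<bullet> x - real k)\<^sup>2)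
       \<and> (\<forall>x::real ^ 'n. sksq_optimal A k \<mu> x \<longrightarrow> sks_optimal A k x)"
proof (intro conjI allI impI)
  fix x :: "real ^ 'n"
  assume "binary_vec x \<and> all_ones \<bullet> x \<noteq> real k"
  then show "1/2 * (x_opt \<bullet> (A *v x_opt))
      < 1/2 * (x \<bullet> (A *v x)) + \<mu>/2 * (all_ones \<bullet> x - real k)\<^sup>2"
    using sks_optimal_less_sksq_objective[of E k x_opt \<mu> x] assms
    by (simp add: sks_objective_def sksq_objective_def)
next
  fix x :: "real ^ 'n"
  assume "sksq_optimal A k \<mu> x"
  then have x: "binary_vec x"
    and min: "\<And>y. binary_vec y \<Longrightarrow> sksq_objective A k \<mu> x \<le> sksq_objective A k \<mu> y"
    by (auto simp: sksq_optimal_def is_arg_min_linorder)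
  \<comment> \<open>The penalty vanishes on feasible points.\<close>
  have agree: "sksq_objective A k \<mu> y = sks_objective A y" if "sks_feasible k y" for y
    using that by (simp add: sksq_objective_eq sks_feasible_def)
  have opt: "sks_feasible k x_opt"
    using assms(5) by (simp add: sks_optimal_def is_arg_min_def)
  then have "sksq_objective A k \<mu> x \<le> sks_objective A x_opt"
    using min[of x_opt] agree[OF opt] by (simp add: sks_feasible_def)
  \<comment> \<open>Otherwise part (i) would make the penalized value at \<open>x\<close> exceed the
    value at \<open>x_opt\<close>, against the minimality of \<open>x\<close>.\<close>
  then have "all_ones \<bullet> x = real k"
    using sks_optimal_less_sksq_objective[of E k x_opt \<mu> x] assms x by force
  with x have feas: "sks_feasible k x" by (simp add: sks_feasible_def)
  have "sks_objective A x \<le> sks_objective A y" if "sks_feasible k y" for y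
    using min[of y] agree[OF feas] agree[OF that] that by (simp add: sks_feasible_def)
  with feas show "sks_optimal A k x"
    by (simp add: sks_optimal_def is_arg_min_linorder)
qed

end
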